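(* Let $P$ be a finite poset with $m$ elements and let $w$ be a natural labeling of $P$. Then for every $n\ge 1$, $$C_n^{P,w}(x) = A_n(x)\, h^*_{P\times[n]}(x).$$ Furthermore, if $P$ is graded (all maximal chains of $P$ have the same length), then $C_n^{P,w}(x)$ is palindromic.
   Context: A labeling of a finite poset $P$ with $m$ elements is a bijection $w:P\to[m]$; it is natural if $s<t$ in $P$ implies $w(s)<w(t)$. A linear extension of $P$ is a listing $(p_1,\dots,p_m)$ of all elements of $P$ such that $p_i<p_j$ in $P$ implies $i<j$; with respect to $w$ it is identified with the word $w(p_1)\cdots w(p_m)$, and its descents are the positions $i\in[m-1]$ with $w(p_i)>w(p_{i+1})$; $\mathrm{des}$ denotes their number. $\mathcal L(P,w)$ denotes the set of linear extensions of $P$ viewed as words via $w$. For a labeled poset $(P,w)$ with $|P|=m$ and $j\ge 0$, let $\Omega_{P,w}(j)$ be the number of maps $\tau:P\to\{0,1,\dots,j\}$ such that $\tau(s)\le\tau(t)$ whenever $s\le t$, and $\tau(s)<\tau(t)$ whenever $s<t$ and $w(s)>w(t)$. The polynomial $h^*_{P,w}(x)$ is defined by $\sum_{j\ge0}\Omega_{P,w}(j)x^j = h^*_{P,w}(x)/(1-x)^{m+1}$; when $w$ is natural it does not depend on $w$ and is written $h^*_P(x)$. $[n]$ denotes the $n$-element chain, $P\times[n]$ carries the product order $(p,j)\le(p',j')$ iff $p\le p'$ and $j\le j'$. For $\sigma\in S_n$ the canon labeling $w\times\sigma$ of $P\times[n]$ is $(w\times\sigma)(p,j)=w(p)+(\sigma(j)-1)m$.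 The canon polynomial is $$C_n^{P,w}(x)=\sum_{\sigma\in S_n}\ \sum_{\pi\in\mathcal L(P\times[n],\,w\times\sigma)} x^{\mathrm{des}(\pi)}.$$ $A_n(x)=\sum_{\sigma\in S_n}x^{\mathrm{des}(\sigma)}$ is the Eulerian polynomial. A polynomial $f$ is palindromic if its coefficient sequence is symmetric, i.e. $x^d f(1/x)=f(x)$ for some integer $d$.
   Formalization: The poset P is assumed nonempty (m ≥ 1), because for the empty poset the identity fails when n ≥ 2: there C_n(x) = n! while A_n(x) h*(x) = A_n(x). *)

theory Defs
  imports
    "HOL-Computational_Algebra.Polynomial_FPS"
    "HOL-Combinatorics.Permutations"
    "HOL-Library.FuncSet"
begin

text \<open>A poset is a carrier \<open>P\<close> together with its reflexive order relation \<open>r\<close>,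
  subject to \<open>partial_order_on P r\<close>.\<close>

definition labeling :: "'a set \<Rightarrow> ('a \<Rightarrow> nat) \<Rightarrow> bool" where
  "labeling P w \<longleftrightarrow> bij_betw w P {1..card P}"

definition natural_labeling :: "'a set \<Rightarrow> 'a rel \<Rightarrow> ('a \<Rightarrow> nat) \<Rightarrow> bool" where
  "natural_labeling P r w \<longleftrightarrow>
     labeling P w \<and> (\<forall>s\<in>P. \<forall>t\<in>P. (s, t) \<in> r \<and> s \<noteq> t \<longrightarrow> w s < w t)"

definition linear_extensions :: "'a set \<Rightarrow> 'a rel \<Rightarrow> 'a list set" where
  "linear_extensions P r = {ps. distinct ps \<and> set ps = P \<and>
     (\<forall>i<length ps. \<forall>j<length ps. (ps ! i, ps ! j) \<in> r \<and> ps ! i \<noteq> ps ! j \<longrightarrow> i < j)}"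

definition lin_ext_words :: "'a set \<Rightarrow> 'a rel \<Rightarrow> ('a \<Rightarrow> nat) \<Rightarrow> nat list set" where
  "lin_ext_words P r w = map w ` linear_extensions P r"

text \<open>Lists are indexed from 0, so descent positions are shifted by one.\<close>

definition des :: "nat list \<Rightarrow> nat" where
  "des u = card {i. Suc i < length u \<and> u ! i > u ! Suc i}"

definition order_count :: "'a set \<Rightarrow> 'a rel \<Rightarrow> ('a \<Rightarrow> nat) \<Rightarrow> nat \<Rightarrow> nat" where
  "order_count P r w j = card {\<tau> \<in> P \<rightarrow>\<^sub>E {0..j}. \<forall>s\<in>P. \<forall>t\<in>P.
     ((s, t) \<in> r \<longrightarrow> \<tau> s \<le> \<tau> t) \<and>
     ((s, t) \<in> r \<and> s \<noteq> t \<and> w s > w t \<longrightarrow> \<tau> s < \<tau> t)}"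

text \<open>The defining equation of \<open>h\<^sup>*\<close>, an identity of formal power series, is
  multiplied by \<open>(1 - x) ^ (m + 1)\<close> so that it can be stated over the integers.\<close>

definition hstar :: "'a set \<Rightarrow> 'a rel \<Rightarrow> ('a \<Rightarrow> nat) \<Rightarrow> int poly" where
  "hstar P r w = (THE h. Abs_fps (\<lambda>j. of_nat (order_count P r w j)) * (1 - fps_X) ^ (card P + 1)
     = fps_of_poly h)"

definition hstar_poset :: "'a set \<Rightarrow> 'a rel \<Rightarrow> int poly" where
  "hstar_poset P r = hstar P r (SOME w. natural_labeling P r w)"

lemma hstar_unique:
  assumes "Abs_fps (\<lambda>j. of_nat (order_count P r w j)) * (1 - fps_X) ^ (card P + 1) = fps_of_poly h"
  shows "hstar P r w = h"
  unfolding hstar_def assms by (rule the_equality) (simp_all add: fps_of_poly_eq_iff)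

lemma hstar_natural_cong:
  assumes "natural_labeling P r v" "natural_labeling P r w"
  shows "hstar P r v = hstar P r w"
proof -
  have "{\<tau> \<in> P \<rightarrow>\<^sub>E {0..j}. \<forall>s\<in>P. \<forall>t\<in>P.
          ((s, t) \<in> r \<longrightarrow> \<tau> s \<le> \<tau> t) \<and> ((s, t) \<in> r \<and> s \<noteq> t \<and> u s > u t \<longrightarrow> \<tau> s < \<tau> t)}
      = {\<tau> \<in> P \<rightarrow>\<^sub>E {0..j}. \<forall>s\<in>P. \<forall>t\<in>P. (s, t) \<in> r \<longrightarrow> \<tau> s \<le> \<tau> t}"
    if "natural_labeling P r u" for u and j :: nat
  proof -
    have "\<not> ((s, t) \<in> r \<and> s \<noteq> t \<and> u s > u t)" if "s \<in> P" "t \<in> P" for s t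
      using \<open>natural_labeling P r u\<close> that unfolding natural_labeling_def
      by (meson less_asym)
    then show ?thesis
      by (intro Collect_cong conj_cong ball_cong refl) blast
  qed
  then have "order_count P r v = order_count P r w"
    using assms by (simp add: order_count_def fun_eq_iff)
  then show ?thesis
    by (simp add: hstar_def)
qed

lemma hstar_poset_eq:
  assumes "natural_labeling P r v"
  shows "hstar_poset P r = hstar P r v"
  unfolding hstar_poset_def by (rule hstar_natural_cong[OF someI[of "natural_labeling P r"]]) (fact assms)+

definition prod_chain_rel :: "'a rel \<Rightarrow> nat \<Rightarrow> ('a \<times> nat) rel" where
  "prod_chain_rel r n = {((p, j), (p', j')).
     (p, p') \<in> r \<and> j \<in> {1..n} \<and> j' \<in> {1..n} \<and> j \<le> j'}"

definition canon_labeling :: "'a set \<Rightarrow> ('a \<Rightarrow> nat) \<Rightarrow> (nat \<Rightarrow> nat) \<Rightarrow> 'a \<times> nat \<Rightarrow> nat" where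
  "canon_labeling P w \<sigma> = (\<lambda>(p, j). w p + (\<sigma> j - 1) * card P)"

definition canon_poly :: "'a set \<Rightarrow> 'a rel \<Rightarrow> ('a \<Rightarrow> nat) \<Rightarrow> nat \<Rightarrow> int poly" where
  "canon_poly P r w n = (\<Sum>\<sigma> | \<sigma> permutes {1..n}.
     \<Sum>\<pi> \<in> lin_ext_words (P \<times> {1..n}) (prod_chain_rel r n) (canon_labeling P w \<sigma>).
       monom 1 (des \<pi>))"

definition eulerian_poly :: "nat \<Rightarrow> int poly" where
  "eulerian_poly n = (\<Sum>\<sigma> | \<sigma> permutes {1..n}. monom 1 (des (map \<sigma> [1..<n+1])))"

text \<open>\<open>x\<^sup>d f(1/x) = f(x)\<close>, compared coefficientwise; this identity forces
  \<open>d \<ge> degree f\<close> unless \<open>f = 0\<close>.\<close>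

definition palindromic :: "int poly \<Rightarrow> bool" where
  "palindromic f \<longleftrightarrow> (\<exists>d. degree f \<le> d \<and> (\<forall>i\<le>d. coeff f i = coeff f (d - i)))"

text \<open>The members of \<open>Chains r\<close> are subsets of \<open>P\<close>, as \<open>r \<subseteq> P \<times> P\<close> for a poset.\<close>

definition maximal_chain :: "'a rel \<Rightarrow> 'a set \<Rightarrow> bool" where
  "maximal_chain r C \<longleftrightarrow> C \<in> Chains r \<and> (\<forall>D\<in>Chains r. C \<subseteq> D \<longrightarrow> D = C)"

text \<open>The length of a chain \<open>C\<close> is \<open>card C - 1\<close>; comparing lengths is comparing cardinalities.\<close>

definition graded :: "'a rel \<Rightarrow> bool" where
  "graded r \<longleftrightarrow> (\<forall>C D. maximal_chain r C \<and> maximal_chain r D \<longrightarrow> card C = card D)"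

end

theory Submission
  imports Defs "HOL-Library.Product_Lexorder"
begin

text \<open>
  By Stanley's theorem, \<open>h\<^sup>*\<close> of a labeled poset is the descent generating polynomial of its linear
  extensions. If a labeled poset \<open>(Q, v)\<close> has a \<open>(Q, v)\<close>-partition \<open>f\<close> whose subtraction turns every
  \<open>(Q, v)\<close>-partition into an order-preserving map, and \<open>f\<close> has maximum \<open>d\<close>, then
  \<open>h\<^sup>*\<^bsub>Q,v\<^esub> = x\<^sup>d h\<^sup>*\<^sub>Q\<close>. On \<open>P \<times> [n]\<close> with labeling \<open>w \<times> \<sigma>\<close> the map
  \<open>(p, j) \<mapsto> #{i < j. \<sigma>(i) > \<sigma>(i + 1)}\<close> is of this kind, with maximum \<open>des \<sigma>\<close>; summing over \<open>\<sigma>\<close>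
  gives the factorization.

  For palindromicity, complement both labelings: let \<open>w'\<close> be \<open>m + 1 - w\<close> and reindex the sum
  by \<open>\<sigma> \<mapsto> n + 1 - \<sigma>\<close>. This turns \<open>des\<close> into \<open>mn - 1 - des\<close>. If \<open>P\<close> is graded of rank \<open>l\<close>
  with rank function \<open>\<rho>\<close>, then \<open>\<rho>\<close> plays the role of \<open>f\<close> for \<open>(P, w')\<close>, and adding the descent
  counts yields the map for \<open>w' \<times> \<sigma>\<close>. Hence \<open>x\<^bsup>mn - 1\<^esup> C\<^sub>n(1/x) = x\<^sup>l C\<^sub>n(x)\<close>.
\<close>

subsection \<open>Stanley's theorem on labeled partitions\<close>

text \<open>Extensionality is added only where maps are counted, so that the notion also applies to
  a row \<open>\<lambda>p. \<tau> (p, j)\<close> of a map on the product.\<close>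

definition pw_partition :: "'a set \<Rightarrow> 'a rel \<Rightarrow> ('a \<Rightarrow> nat) \<Rightarrow> nat \<Rightarrow> ('a \<Rightarrow> nat) \<Rightarrow> bool" where
  "pw_partition P r w k \<tau> \<longleftrightarrow> (\<forall>s\<in>P. \<tau> s \<le> k) \<and>
     (\<forall>s\<in>P. \<forall>t\<in>P. (s, t) \<in> r \<longrightarrow> \<tau> s \<le> \<tau> t \<and> (s \<noteq> t \<and> w t < w s \<longrightarrow> \<tau> s < \<tau> t))"

lemma order_count_eq_card:
  "order_count P r w k = card {\<tau> \<in> extensional P. pw_partition P r w k \<tau>}"
  unfolding order_count_def pw_partition_def
  by (rule arg_cong[where f = card]) (auto simp: PiE_def Pi_def)

section \<open>Partitions compatible with one linear extension\<close>

text \<open>Pairs are compared lexicographically. For distinct \<open>ps\<close> and injective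
  \<open>w\<close> the condition says that the values rise weakly along \<open>ps\<close>, and
  strictly at each descent of \<open>map w ps\<close>.\<close>

definition sorted_fillings :: "('a \<Rightarrow> nat) \<Rightarrow> 'a list \<Rightarrow> nat \<Rightarrow> ('a \<Rightarrow> nat) set" where
  "sorted_fillings w ps j =
     {\<tau> \<in> set ps \<rightarrow>\<^sub>E {0..j}. sorted_wrt (\<lambda>s t. (\<tau> s, w s) < (\<tau> t, w t)) ps}"

lemma finite_sorted_fillings [simp]: "finite (sorted_fillings w ps j)"
  unfolding sorted_fillings_def
  by (rule finite_subset[of _ "set ps \<rightarrow>\<^sub>E {0..j}"]) (auto intro: finite_PiE)

lemma des_snoc: "des (u @ [b]) = des u + (if u \<noteq> [] \<and> last u > b then 1 else 0)"
proof -
  let ?D = "\<lambda>u. {i. Suc i < length u \<and> u ! i > u ! Suc i}"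
  let ?E = "if u \<noteq> [] \<and> last u > b then {length u - 1} else {}"
  have "?D (u @ [b]) = ?D u \<union> ?E"
  proof (rule set_eqI)
    fix i
    consider "Suc i < length u" | "Suc i = length u" | "Suc i > length u" by linarith
    then show "i \<in> ?D (u @ [b]) \<longleftrightarrow> i \<in> ?D u \<union> ?E"
    proof cases
      case 1 then show ?thesis by (simp add: nth_append) auto
    next
      case 2
      then have "last u = u ! i" "u \<noteq> []" by (cases u; auto simp: last_conv_nth simp flip: 2)+
      then show ?thesis using 2 by (simp add: nth_append flip: 2)
    next
      case 3 then show ?thesis by (cases u) auto
    qed
  qed
  moreover have "finite (?D u)" by (rule finite_subset[of _ "{..<length u}"]) auto
  moreover have "?D u \<inter> ?E = {}" by auto
  ultimately show ?thesis
    unfolding des_def by (simp add: card_Un_disjoint)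
qed

text \<open>The second summand counts the fillings whose value at \<open>q\<close> is exactly \<open>j\<close>.\<close>

lemma card_sorted_fillings_snoc:
  assumes "distinct (ps @ [q])" and "inj_on w (set (ps @ [q]))"
  defines "e \<equiv> if ps \<noteq> [] \<and> w (last ps) > w q then 1 else 0"
  shows "card (sorted_fillings w (ps @ [q]) j) =
    (if j = 0 then 0 else card (sorted_fillings w (ps @ [q]) (j - 1))) +
    (if j < e then 0 else card (sorted_fillings w ps (j - e)))"
proof -
  let ?S = "sorted_fillings w"
  let ?A = "{\<tau> \<in> ?S (ps @ [q]) j. \<tau> q < j}"
  let ?B = "{\<tau> \<in> ?S (ps @ [q]) j. \<tau> q = j}"
  have q: "q \<notin> set ps" using assms(1) by auto
  have "?S (ps @ [q]) j = ?A \<union> ?B"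
    by (auto simp: sorted_fillings_def PiE_def Pi_def)
  moreover have "card (?A \<union> ?B) = card ?A + card ?B"
    by (rule card_Un_disjoint) auto
  moreover have "card ?A = (if j = 0 then 0 else card (?S (ps @ [q]) (j - 1)))"
  proof (cases "j = 0")
    case False
    have "?A = ?S (ps @ [q]) (j - 1)"
    proof (intro set_eqI iffI)
      fix \<tau> assume "\<tau> \<in> ?A"
      then show "\<tau> \<in> ?S (ps @ [q]) (j - 1)"
        by (fastforce simp: sorted_fillings_def PiE_def Pi_def sorted_wrt_append)
    next
      fix \<tau> assume "\<tau> \<in> ?S (ps @ [q]) (j - 1)"
      then show "\<tau> \<in> ?A" using False
        by (fastforce simp: sorted_fillings_def PiE_def Pi_def sorted_wrt_append)
    qed
    then show ?thesis using False by simp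
  qed auto
  moreover have "card ?B = (if j < e then 0 else card (?S ps (j - e)))"
  proof -
    \<comment> \<open>The keys increase along \<open>ps\<close>, so only its last entry has to be
      compared with \<open>q\<close>. There the labels decide whether the value \<open>j\<close>
      itself is allowed, and \<open>e\<close> records the answer.\<close>
    have snoc: "(\<forall>p\<in>set ps. (\<tau> p, w p) < (j, w q)) \<longleftrightarrow> (\<forall>p\<in>set ps. \<tau> p + e \<le> j)"
      if s: "sorted_wrt (\<lambda>s t. (\<tau> s, w s) < (\<tau> t, w t)) ps" for \<tau>
    proof (cases "ps = []")
      case False
      then obtain ps' l where ps: "ps = ps' @ [l]" by (metis rev_exhaust)
      have l: "(\<tau> p, w p) < (\<tau> l, w l)" if "p \<in> set ps'" for p
        using s that by (auto simp: ps sorted_wrt_append)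
      have "w l \<noteq> w q" using assms(2) q by (auto simp: ps inj_on_def)
      then have last: "(\<tau> l, w l) < (j, w q) \<longleftrightarrow> \<tau> l + e \<le> j"
        by (auto simp: e_def ps)
      show ?thesis
      proof
        assume "\<forall>p\<in>set ps. (\<tau> p, w p) < (j, w q)"
        then have "\<tau> l + e \<le> j" using last by (auto simp: ps)
        moreover have "\<tau> p \<le> \<tau> l" if "p \<in> set ps" for p
          using that l by (fastforce simp: ps)
        ultimately show "\<forall>p\<in>set ps. \<tau> p + e \<le> j" by fastforce
      next
        assume "\<forall>p\<in>set ps. \<tau> p + e \<le> j"
        then have "(\<tau> l, w l) < (j, w q)" using last by (auto simp: ps)
        then show "\<forall>p\<in>set ps. (\<tau> p, w p) < (j, w q)"
          using l less_trans unfolding ps by fastforce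
      qed
    qed simp
    show ?thesis
    proof (cases "j < e")
      case True
      then have "j = 0" "e = 1" by (auto simp: e_def split: if_splits)
      then have ne: "ps \<noteq> []" by (auto simp: e_def)
      \<comment> \<open>With \<open>j = 0\<close> and a descent before \<open>q\<close>, the entries
        of \<open>ps\<close> would need values below 0.\<close>
      have "?B = {}"
      proof (rule ccontr)
        assume "?B \<noteq> {}"
        then obtain \<tau> where t: "\<tau> \<in> ?S (ps @ [q]) j" "\<tau> q = j" by auto
        then have "\<forall>p\<in>set ps. \<tau> p + e \<le> j" using snoc[of \<tau>]
          by (auto simp: sorted_fillings_def sorted_wrt_append)
        with \<open>j = 0\<close> \<open>e = 1\<close> ne show False by (cases ps) auto
      qed
      then show ?thesis using True by simp
    next
      case False
      \<comment> \<open>Once the value at \<open>q\<close> is fixed to \<open>j\<close>, what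
        remains is a filling of \<open>ps\<close> bounded by \<open>j - e\<close>.\<close>
      have "bij_betw (\<lambda>\<tau>. \<tau>(q := j)) (?S ps (j - e)) ?B"
      proof (rule bij_betw_byWitness[where f' = "\<lambda>\<tau>. restrict \<tau> (set ps)"])
        show "\<forall>\<tau>\<in>?S ps (j - e). restrict (\<tau>(q := j)) (set ps) = \<tau>"
          using q by (auto simp: sorted_fillings_def PiE_def extensional_def restrict_def fun_eq_iff)
        show "\<forall>\<tau>\<in>?B. (restrict \<tau> (set ps))(q := j) = \<tau>"
          by (auto simp: sorted_fillings_def PiE_def extensional_def restrict_def fun_eq_iff)
        show "(\<lambda>\<tau>. \<tau>(q := j)) ` ?S ps (j - e) \<subseteq> ?B"
        proof (rule image_subsetI)
          fix \<tau> assume t: "\<tau> \<in> ?S ps (j - e)"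
          let ?t = "\<tau>(q := j)"
          have "sorted_wrt (\<lambda>s t. (?t s, w s) < (?t t, w t)) ps"
            by (rule sorted_wrt_mono_rel[of _ "\<lambda>s t. (\<tau> s, w s) < (\<tau> t, w t)"])
              (use t q in \<open>auto simp: sorted_fillings_def\<close>)
          moreover have "\<forall>p\<in>set ps. ?t p + e \<le> j"
            using t q False by (fastforce simp: sorted_fillings_def PiE_def Pi_def)
          ultimately have "sorted_wrt (\<lambda>s t. (?t s, w s) < (?t t, w t)) (ps @ [q])"
            using snoc[of ?t] by (auto simp: sorted_wrt_append)
          moreover have "?t \<in> set (ps @ [q]) \<rightarrow>\<^sub>E {0..j}"
            using t by (fastforce simp: sorted_fillings_def PiE_def Pi_def extensional_def)
          ultimately show "?t \<in> ?B" by (simp add: sorted_fillings_def)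
        qed
        show "(\<lambda>\<tau>. restrict \<tau> (set ps)) ` ?B \<subseteq> ?S ps (j - e)"
        proof (rule image_subsetI)
          fix \<tau> assume t: "\<tau> \<in> ?B"
          then have s: "sorted_wrt (\<lambda>s t. (\<tau> s, w s) < (\<tau> t, w t)) ps"
            by (auto simp: sorted_fillings_def sorted_wrt_append)
          have "\<forall>p\<in>set ps. \<tau> p + e \<le> j"
            using t snoc[OF s] by (auto simp: sorted_fillings_def sorted_wrt_append)
          then have "restrict \<tau> (set ps) \<in> set ps \<rightarrow>\<^sub>E {0..j - e}"
            by fastforce
          moreover have "sorted_wrt (\<lambda>s t. (restrict \<tau> (set ps) s, w s) <
              (restrict \<tau> (set ps) t, w t)) ps"
            by (rule sorted_wrt_mono_rel[OF _ s]) auto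
          ultimately show "restrict \<tau> (set ps) \<in> ?S ps (j - e)"
            by (simp add: sorted_fillings_def)
        qed
      qed
      then show ?thesis using False by (simp add: bij_betw_same_card)
    qed
  qed
  ultimately show ?thesis by simp
qed

text \<open>By the recurrence, appending \<open>q\<close> multiplies the series by
  \<open>x^e / (1 - x)\<close>, where \<open>e\<close> is 1 exactly if a new descent arises.
  Induction from the right collects one denominator per entry and one \<open>x\<close> per
  descent.\<close>

lemma sorted_fillings_gf:
  assumes "distinct ps" and "inj_on w (set ps)"
  shows "Abs_fps (\<lambda>j. int (card (sorted_fillings w ps j))) * (1 - fps_X) ^ (length ps + 1)
    = fps_X ^ des (map w ps)"
  using assms
proof (induction ps rule: rev_induct)
  case Nil
  \<comment> \<open>There is one filling for every bound, so the series is
    \<open>1 / (1 - x)\<close>; this is the source of the \<open>+ 1\<close> in the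
    exponent.\<close>
  have "sorted_fillings w [] j = {\<lambda>_. undefined}" for j
    by (auto simp: sorted_fillings_def)
  then have "Abs_fps (\<lambda>j. int (card (sorted_fillings w [] j))) * (1 - fps_X) = 1"
    by (intro fps_ext) (simp add: algebra_simps)
  then show ?case by (simp add: des_def)
next
  case (snoc q ps)
  define e :: nat where "e = (if ps \<noteq> [] \<and> w (last ps) > w q then 1 else 0)"
  let ?F = "\<lambda>ps. Abs_fps (\<lambda>j. int (card (sorted_fillings w ps j)))"
  have "?F (ps @ [q]) * (1 - fps_X) = ?F ps * fps_X ^ e"
  proof (rule fps_ext)
    fix j
    show "fps_nth (?F (ps @ [q]) * (1 - fps_X)) j = fps_nth (?F ps * fps_X ^ e) j"
      using card_sorted_fillings_snoc[OF snoc.prems, of j, folded e_def]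
      by (auto simp: algebra_simps fps_X_power_mult_nth)
  qed
  moreover have "?F ps * (1 - fps_X) ^ (length ps + 1) = fps_X ^ des (map w ps)"
    using snoc by (auto intro: inj_on_subset)
  moreover have "des (map w (ps @ [q])) = des (map w ps) + e"
    by (auto simp: des_snoc e_def last_map)
  ultimately show ?case
    by (simp add: power_add) (metis (no_types, lifting) mult.assoc mult.commute)
qed

section \<open>Splitting partitions by linear extensions\<close>

lemma finite_linear_extensions: "finite Q \<Longrightarrow> finite (linear_extensions Q r)"
  unfolding linear_extensions_def
  by (rule finite_subset[OF _ finite_subset_distinct[of Q]]) auto

text \<open>A partition \<open>\<tau>\<close> belongs to the linear extension obtained by sorting \<open>Q\<close> by \<open>\<tau>\<close>, ties broken
  by \<open>w\<close>.\<close>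

lemma pw_partitions_eq_Union_sorted_fillings:
  assumes "finite Q" and inj: "inj_on w Q"
  shows "{\<tau> \<in> extensional Q. pw_partition Q r w k \<tau>} =
    (\<Union>ps\<in>linear_extensions Q r. sorted_fillings w ps k)"
proof (intro set_eqI iffI)
  fix \<tau> assume t: "\<tau> \<in> {\<tau> \<in> extensional Q. pw_partition Q r w k \<tau>}"
  let ?key = "\<lambda>s. (\<tau> s, w s)"
  obtain xs where xs: "set xs = Q" "distinct xs" using finite_distinct_list[OF assms(1)] by auto
  define ps where "ps = sort_key ?key xs"
  have ps: "set ps = Q" "distinct ps" "sorted (map ?key ps)"
    using xs by (auto simp: ps_def)
  have "inj_on ?key (set ps)" using inj ps by (auto simp: inj_on_def)
  then have "sorted_wrt (<) (map ?key ps)"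
    using ps by (simp add: strict_sorted_iff distinct_map)
  then have s: "sorted_wrt (\<lambda>s t. ?key s < ?key t) ps"
    by (simp add: sorted_wrt_map)
  \<comment> \<open>If the larger element came first in the sorted list, \<open>\<tau>\<close> would
    either decrease along the relation, or stay equal where the labels drop and strictness is
    required.\<close>
  have "i < j" if ij: "i < length ps" "j < length ps" "(ps ! i, ps ! j) \<in> r" "ps ! i \<noteq> ps ! j" for i j
  proof (rule ccontr)
    assume "\<not> i < j"
    with ij have "j < i" by (metis linorder_neqE_nat)
    then have "?key (ps ! j) < ?key (ps ! i)"
      using s ij by (simp add: sorted_wrt_iff_nth_less)
    moreover have "ps ! i \<in> Q" "ps ! j \<in> Q" using ps ij by auto
    moreover have "w (ps ! i) \<noteq> w (ps ! j)"
      using inj ij calculation by (auto simp: inj_on_def)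
    ultimately show False using t ij by (fastforce simp: pw_partition_def)
  qed
  then have "ps \<in> linear_extensions Q r"
    using ps by (auto simp: linear_extensions_def)
  moreover have "\<tau> \<in> sorted_fillings w ps k"
    using t s ps by (auto simp: sorted_fillings_def PiE_def Pi_def pw_partition_def)
  ultimately show "\<tau> \<in> (\<Union>ps\<in>linear_extensions Q r. sorted_fillings w ps k)" by auto
next
  fix \<tau> assume "\<tau> \<in> (\<Union>ps\<in>linear_extensions Q r. sorted_fillings w ps k)"
  then obtain ps where ps: "ps \<in> linear_extensions Q r" and t: "\<tau> \<in> sorted_fillings w ps k" by auto
  have Q: "set ps = Q" using ps by (simp add: linear_extensions_def)
  have lt: "(\<tau> s, w s) < (\<tau> t, w t)" if st: "s \<in> Q" "t \<in> Q" "(s, t) \<in> r" "s \<noteq> t" for s t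
  proof -
    obtain i j where ij: "i < length ps" "j < length ps" "s = ps ! i" "t = ps ! j"
      using st Q by (metis in_set_conv_nth)
    then have "i < j" using ps st by (auto simp: linear_extensions_def)
    then show ?thesis using t ij by (auto simp: sorted_fillings_def sorted_wrt_iff_nth_less)
  qed
  have "\<tau> s \<le> \<tau> t" if "s \<in> Q" "t \<in> Q" "(s, t) \<in> r" for s t
    using lt[of s t] that by (cases "s = t") auto
  moreover have "\<tau> s < \<tau> t" if "s \<in> Q" "t \<in> Q" "(s, t) \<in> r" "s \<noteq> t" "w t < w s" for s t
    using lt[of s t] that by auto
  ultimately show "\<tau> \<in> {\<tau> \<in> extensional Q. pw_partition Q r w k \<tau>}"
    using t Q by (auto simp: sorted_fillings_def PiE_def Pi_def pw_partition_def)
qed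

text \<open>A list that is strictly sorted by a key injective on its entries is determined by its
  set, so \<open>\<tau>\<close> determines its linear extension.\<close>

lemma sorted_fillings_disjoint:
  assumes "inj_on w Q" "ps \<in> linear_extensions Q r" "qs \<in> linear_extensions Q r" "ps \<noteq> qs"
  shows "sorted_fillings w ps k \<inter> sorted_fillings w qs k = {}"
proof (rule ccontr)
  assume "sorted_fillings w ps k \<inter> sorted_fillings w qs k \<noteq> {}"
  then obtain \<tau> where t: "\<tau> \<in> sorted_fillings w ps k" "\<tau> \<in> sorted_fillings w qs k" by auto
  let ?key = "\<lambda>s. (\<tau> s, w s)"
  have "sorted_wrt (<) (map ?key ps)" "sorted_wrt (<) (map ?key qs)"
    using t by (simp_all add: sorted_fillings_def sorted_wrt_map)
  moreover have "set ps = Q" "set qs = Q" using assms by (auto simp: linear_extensions_def)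
  moreover have "inj_on ?key Q" using assms(1) by (auto simp: inj_on_def)
  ultimately have "ps = qs"
    by (intro map_sorted_distinct_set_unique[of ?key]) (auto simp: strict_sorted_iff)
  with assms show False by simp
qed

text \<open>The classes of partitions belonging to the linear extensions are disjoint, and each
  contributes \<open>x^des / (1 - x)^(card Q + 1)\<close>. In particular the polynomial described by
  \<open>hstar\<close> exists.\<close>

theorem order_count_gf:
  assumes "finite Q" and "inj_on w Q"
  shows "Abs_fps (\<lambda>j. of_nat (order_count Q r w j)) * (1 - fps_X) ^ (card Q + 1) =
    fps_of_poly (\<Sum>ps\<in>linear_extensions Q r. monom 1 (des (map w ps)) :: int poly)"
proof -
  let ?L = "linear_extensions Q r"
  have "order_count Q r w j = (\<Sum>ps\<in>?L. card (sorted_fillings w ps j))" for j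
    unfolding order_count_eq_card pw_partitions_eq_Union_sorted_fillings[OF assms]
    by (rule card_UN_disjoint)
      (use finite_linear_extensions[OF assms(1)] sorted_fillings_disjoint[OF assms(2)] in \<open>simp_all\<close>)
  then have "Abs_fps (\<lambda>j. of_nat (order_count Q r w j)) =
      (\<Sum>ps\<in>?L. Abs_fps (\<lambda>j. int (card (sorted_fillings w ps j))))"
    by (intro fps_ext) (simp add: fps_sum_nth)
  then have "Abs_fps (\<lambda>j. of_nat (order_count Q r w j)) * (1 - fps_X) ^ (card Q + 1) =
      (\<Sum>ps\<in>?L. Abs_fps (\<lambda>j. int (card (sorted_fillings w ps j))) * (1 - fps_X) ^ (card Q + 1))"
    by (simp add: sum_distrib_right)
  also have "\<dots> = (\<Sum>ps\<in>?L. fps_X ^ des (map w ps))"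
  proof (rule sum.cong[OF refl])
    fix ps assume "ps \<in> ?L"
    then have "distinct ps" "set ps = Q" by (auto simp: linear_extensions_def)
    then show "Abs_fps (\<lambda>j. int (card (sorted_fillings w ps j))) * (1 - fps_X) ^ (card Q + 1) =
        fps_X ^ des (map w ps)"
      using sorted_fillings_gf[of ps w] assms by (metis distinct_card)
  qed
  finally show ?thesis by (simp add: fps_of_poly_sum fps_of_poly_monom')
qed

corollary hstar_eq_sum_des:
  assumes "finite Q" and "inj_on w Q"
  shows "hstar Q r w = (\<Sum>ps\<in>linear_extensions Q r. monom 1 (des (map w ps)))"
  by (rule hstar_unique) (rule order_count_gf[OF assms])

subsection \<open>Least partitions\<close>

text \<open>The clauses on \<open>\<tau>\<close> say that \<open>\<tau> - f\<close> is nonnegative,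
  bounded by \<open>k - d\<close> and order-preserving. They are written additively to avoid
  truncated subtraction.\<close>

definition least_partition :: "'a set \<Rightarrow> 'a rel \<Rightarrow> ('a \<Rightarrow> nat) \<Rightarrow> ('a \<Rightarrow> nat) \<Rightarrow> nat \<Rightarrow> bool" where
  "least_partition P r v f d \<longleftrightarrow> pw_partition P r v d f \<and>
     (\<forall>k \<tau>. pw_partition P r v k \<tau> \<longrightarrow>
        (\<forall>s\<in>P. f s \<le> \<tau> s \<and> \<tau> s + d \<le> k + f s) \<and>
        (\<forall>s\<in>P. \<forall>t\<in>P. (s, t) \<in> r \<longrightarrow> \<tau> s + f t \<le> \<tau> t + f s))"

lemma pw_partition_natural:
  assumes "natural_labeling Q r u"
  shows "pw_partition Q r u k \<tau> \<longleftrightarrow>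
    (\<forall>s\<in>Q. \<tau> s \<le> k) \<and> (\<forall>s\<in>Q. \<forall>t\<in>Q. (s, t) \<in> r \<longrightarrow> \<tau> s \<le> \<tau> t)"
  using assms unfolding pw_partition_def natural_labeling_def by (meson less_asym)

text \<open>A natural labeling imposes no strict inequalities, so its partitions are the
  order-preserving maps. Adding \<open>f\<close> sends those bounded by \<open>k - d\<close> to the
  partitions for \<open>v\<close> bounded by \<open>k\<close>, and subtracting \<open>f\<close> is
  the inverse.\<close>

lemma order_count_least_partition:
  assumes "Q \<noteq> {}" and nat: "natural_labeling Q r u" and least: "least_partition Q r v f d"
  shows "order_count Q r v k = (if k < d then 0 else order_count Q r u (k - d))"
proof (cases "k < d")
  case True
  \<comment> \<open>At a single element, the lower and the upper bound together already force
    \<open>d \<le> k\<close>.\<close>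
  obtain s where s: "s \<in> Q" using assms(1) by auto
  have "\<not> pw_partition Q r v k \<tau>" for \<tau>
  proof
    assume "pw_partition Q r v k \<tau>"
    then have "f s \<le> \<tau> s" "\<tau> s + d \<le> k + f s"
      using least s by (auto simp: least_partition_def)
    with True show False by simp
  qed
  then show ?thesis using True by (simp add: order_count_eq_card)
next
  case False
  have f: "f s \<le> d" "(s, t) \<in> r \<Longrightarrow> f s \<le> f t"
    "(s, t) \<in> r \<Longrightarrow> s \<noteq> t \<Longrightarrow> v t < v s \<Longrightarrow> f s < f t" if "s \<in> Q" "t \<in> Q" for s t
    using least that by (auto simp: least_partition_def pw_partition_def)
  have "bij_betw (\<lambda>\<tau>. \<lambda>s\<in>Q. \<tau> s + f s) {\<tau> \<in> extensional Q. pw_partition Q r u (k - d) \<tau>}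
     {\<tau> \<in> extensional Q. pw_partition Q r v k \<tau>}" (is "bij_betw _ ?A ?B")
  proof (rule bij_betw_byWitness[where f' = "\<lambda>\<tau>. \<lambda>s\<in>Q. \<tau> s - f s"])
    show "\<forall>\<tau>\<in>?A. (\<lambda>s\<in>Q. (\<lambda>s\<in>Q. \<tau> s + f s) s - f s) = \<tau>"
      by (auto simp: fun_eq_iff restrict_def extensional_def)
    show "\<forall>\<tau>\<in>?B. (\<lambda>s\<in>Q. (\<lambda>s\<in>Q. \<tau> s - f s) s + f s) = \<tau>"
      using least by (auto simp: fun_eq_iff restrict_def extensional_def least_partition_def)
    show "(\<lambda>\<tau>. \<lambda>s\<in>Q. \<tau> s + f s) ` ?A \<subseteq> ?B"
    proof (rule image_subsetI)
      fix \<tau> assume "\<tau> \<in> ?A"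
      then have \<tau>: "\<tau> s \<le> k - d" "(s, t) \<in> r \<Longrightarrow> \<tau> s \<le> \<tau> t" if "s \<in> Q" "t \<in> Q" for s t
        using that by (auto simp: pw_partition_natural[OF nat])
      have "\<tau> s + f s \<le> k" if "s \<in> Q" for s
        using \<tau>(1)[OF that that] f(1)[OF that that] False by linarith
      moreover have "\<tau> s + f s \<le> \<tau> t + f t" if "s \<in> Q" "t \<in> Q" "(s, t) \<in> r" for s t
        using \<tau>(2)[of s t] f(2)[of s t] that by linarith
      moreover have "\<tau> s + f s < \<tau> t + f t"
        if "s \<in> Q" "t \<in> Q" "(s, t) \<in> r" "s \<noteq> t" "v t < v s" for s t
        using \<tau>(2)[of s t] f(3)[of s t] that by linarith
      ultimately show "(\<lambda>s\<in>Q. \<tau> s + f s) \<in> ?B"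
        by (auto simp: pw_partition_def)
    qed
    show "(\<lambda>\<tau>. \<lambda>s\<in>Q. \<tau> s - f s) ` ?B \<subseteq> ?A"
    proof (rule image_subsetI)
      fix \<tau> assume "\<tau> \<in> ?B"
      then have \<tau>: "f s \<le> \<tau> s" "\<tau> s + d \<le> k + f s" "(s, t) \<in> r \<Longrightarrow> \<tau> s + f t \<le> \<tau> t + f s"
        if "s \<in> Q" "t \<in> Q" for s t
        using that least by (auto simp: least_partition_def)
      have "\<tau> s - f s \<le> k - d" if "s \<in> Q" for s
        using \<tau>(1,2)[OF that that] by linarith
      moreover have "\<tau> s - f s \<le> \<tau> t - f t" if "s \<in> Q" "t \<in> Q" "(s, t) \<in> r" for s t
        using \<tau>(3)[of s t] \<tau>(1)[of t t] that by linarith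
      ultimately show "(\<lambda>s\<in>Q. \<tau> s - f s) \<in> ?A"
        by (auto simp: pw_partition_natural[OF nat])
    qed
  qed
  then show ?thesis using False by (simp add: order_count_eq_card bij_betw_same_card)
qed

text \<open>The counting sequence is shifted by \<open>d\<close>, while the power of
  \<open>1 - x\<close> stays the same.\<close>

lemma hstar_least_partition:
  assumes "finite Q" and "Q \<noteq> {}" and nat: "natural_labeling Q r u"
    and least: "least_partition Q r v f d"
  shows "hstar Q r v = monom 1 d * hstar Q r u"
proof (rule hstar_unique)
  have inj: "inj_on u Q"
    using nat by (auto simp: natural_labeling_def labeling_def bij_betw_def)
  have "Abs_fps (\<lambda>j. of_nat (order_count Q r v j)) =
      fps_X ^ d * Abs_fps (\<lambda>j. of_nat (order_count Q r u j) :: int)"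
    by (intro fps_ext)
      (simp add: fps_X_power_mult_nth order_count_least_partition[OF assms(2) nat least])
  then show "Abs_fps (\<lambda>j. of_nat (order_count Q r v j)) * (1 - fps_X) ^ (card Q + 1) =
      fps_of_poly (monom 1 d * hstar Q r u)"
    using order_count_gf[OF assms(1) inj, of r]
    by (simp only: fps_of_poly_mult fps_of_poly_monom' mult.assoc hstar_eq_sum_des[OF assms(1) inj])
qed

lemma least_partition_zero:
  assumes "natural_labeling P r w"
  shows "least_partition P r w (\<lambda>_. 0) 0"
  using assms by (auto simp: least_partition_def pw_partition_natural)

subsection \<open>Canon labelings\<close>

text \<open>Positions are counted from 1, as for permutations of \<open>{1..n}\<close>: the value at
  1 is 0, and the value at \<open>n\<close> is the descent number of
  \<open>\<sigma>\<close>.\<close>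

definition descents_before :: "(nat \<Rightarrow> nat) \<Rightarrow> nat \<Rightarrow> nat" where
  "descents_before \<sigma> j = card {i \<in> {1..<j}. \<sigma> (Suc i) < \<sigma> i}"

lemma descents_before_Suc:
  assumes "j \<ge> 1"
  shows "descents_before \<sigma> (Suc j) = descents_before \<sigma> j + (if \<sigma> (Suc j) < \<sigma> j then 1 else 0)"
proof -
  have "{i \<in> {1..<Suc j}. \<sigma> (Suc i) < \<sigma> i} =
      (if \<sigma> (Suc j) < \<sigma> j then insert j {i \<in> {1..<j}. \<sigma> (Suc i) < \<sigma> i}
       else {i \<in> {1..<j}. \<sigma> (Suc i) < \<sigma> i})"
    using assms by (auto simp: less_Suc_eq)
  then show ?thesis by (simp add: descents_before_def)
qed

lemma descents_before_mono: "i \<le> j \<Longrightarrow> descents_before \<sigma> i \<le> descents_before \<sigma> j"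
  unfolding descents_before_def by (rule card_mono) auto

text \<open>An overall drop of \<open>\<sigma>\<close> forces an adjacent drop in between. Either
  the last step is a descent, or the drop is already present one position earlier and induction
  applies.\<close>

lemma descents_before_less:
  assumes "1 \<le> i" "i < j" "\<sigma> j < \<sigma> i"
  shows "descents_before \<sigma> i < descents_before \<sigma> j"
  using assms(2,3)
proof (induction j rule: less_induct)
  case (less j)
  then obtain j' where j: "j = Suc j'" "i \<le> j'" by (cases j) auto
  show ?case
  proof (cases "\<sigma> j < \<sigma> j'")
    case True
    then show ?thesis
      using descents_before_Suc[of j' \<sigma>] descents_before_mono[OF j(2), of \<sigma>] j assms(1) by simp
  next
    case False
    then have "\<sigma> j' < \<sigma> i" using less.prems by simp
    moreover from this have "i < j'" using j(2) by (metis le_neq_implies_less less_irrefl)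
    ultimately have "descents_before \<sigma> i < descents_before \<sigma> j'" using less.IH j by simp
    then show ?thesis using descents_before_mono[of j' j \<sigma>] j by simp
  qed
qed

lemma des_map_upt: "des (map \<sigma> [1..<n+1]) = descents_before \<sigma> n"
proof -
  have "bij_betw Suc {i. Suc i < n \<and> \<sigma> (Suc (Suc i)) < \<sigma> (Suc i)}
      {i \<in> {1..<n}. \<sigma> (Suc i) < \<sigma> i}"
    by (rule bij_betw_byWitness[where f' = "\<lambda>i. i - 1"]) auto
  moreover have "{i. Suc i < length (map \<sigma> [1..<n+1]) \<and>
        map \<sigma> [1..<n+1] ! i > map \<sigma> [1..<n+1] ! Suc i} =
      {i. Suc i < n \<and> \<sigma> (Suc (Suc i)) < \<sigma> (Suc i)}"
    by (auto simp del: upt_Suc)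
  ultimately show ?thesis
    unfolding des_def descents_before_def by (simp only: bij_betw_same_card)
qed

text \<open>The labels at height \<open>i\<close> fill a block of \<open>card P\<close> consecutive
  integers. The blocks are ordered by \<open>\<sigma>\<close>, and inside a block \<open>v\<close>
  decides.\<close>

lemma canon_labeling_less_iff:
  assumes v: "labeling P v" and \<sigma>: "\<sigma> permutes {1..n}"
    and "p \<in> P" "p' \<in> P" "i \<in> {1..n}" "i' \<in> {1..n}"
  shows "canon_labeling P v \<sigma> (p, i) < canon_labeling P v \<sigma> (p', i') \<longleftrightarrow>
    \<sigma> i < \<sigma> i' \<or> i = i' \<and> v p < v p'"
proof -
  have vb: "1 \<le> v q \<and> v q \<le> card P" if "q \<in> P" for q
    using v that by (auto simp: labeling_def bij_betw_def)
  have \<sigma>b: "1 \<le> \<sigma> k" if "k \<in> {1..n}" for k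
    using permutes_in_image[OF \<sigma>, of k] that by auto
  have lt: "canon_labeling P v \<sigma> (q, k) < canon_labeling P v \<sigma> (q', k')"
    if "q \<in> P" "q' \<in> P" "k \<in> {1..n}" "\<sigma> k < \<sigma> k'" for q q' k k'
  proof -
    have "\<sigma> k - 1 + 1 \<le> \<sigma> k' - 1" using \<sigma>b[of k] that by linarith
    then have "(\<sigma> k - 1 + 1) * card P \<le> (\<sigma> k' - 1) * card P" by (rule mult_le_mono1)
    then have "(\<sigma> k - 1) * card P + card P \<le> (\<sigma> k' - 1) * card P" by simp
    then show ?thesis using vb[of q] vb[of q'] that
      unfolding canon_labeling_def by simp
  qed
  consider "\<sigma> i < \<sigma> i'" | "\<sigma> i' < \<sigma> i" | "i = i'"
    using permutes_inj[OF \<sigma>] by (metis inj_eq linorder_neqE_nat)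
  then show ?thesis
  proof cases
    case 1 then show ?thesis using lt assms by auto
  next
    case 2
    then have "canon_labeling P v \<sigma> (p', i') < canon_labeling P v \<sigma> (p, i)" using lt assms by auto
    with 2 show ?thesis by auto
  next
    case 3 then show ?thesis by (simp add: canon_labeling_def)
  qed
qed

text \<open>A partition of the product restricts at each height to one for \<open>(P, v)\<close>,
  which \<open>f\<close> controls. Up a column it must rise strictly at each descent of
  \<open>\<sigma>\<close>, which \<open>descents_before\<close> controls. A general relation is a
  climb in a column followed by a move within a row.\<close>

lemma least_partition_prod_chain:
  assumes refl: "refl_on P r" and n: "n \<ge> 1" and v: "labeling P v" and \<sigma>: "\<sigma> permutes {1..n}"
    and least: "least_partition P r v f d"
  shows "least_partition (P \<times> {1..n}) (prod_chain_rel r n) (canon_labeling P v \<sigma>)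
    (\<lambda>(p, j). f p + descents_before \<sigma> j) (d + descents_before \<sigma> n)"
proof -
  let ?R = "prod_chain_rel r n" and ?u = "canon_labeling P v \<sigma>" and ?c = "descents_before \<sigma>"
  have fle: "f p \<le> d" if "p \<in> P" for p
    using least that by (auto simp: least_partition_def pw_partition_def)
  have fmono: "f p \<le> f q" if "p \<in> P" "q \<in> P" "(p, q) \<in> r" for p q
    using least that by (auto simp: least_partition_def pw_partition_def)
  have fless: "f p < f q" if "p \<in> P" "q \<in> P" "(p, q) \<in> r" "v q < v p" for p q
    using least that by (auto simp: least_partition_def pw_partition_def)
  have "pw_partition (P \<times> {1..n}) ?R ?u (d + ?c n) (\<lambda>(p, j). f p + ?c j)"
  proof -
    have "f p + ?c i \<le> d + ?c n" if "p \<in> P" "i \<in> {1..n}" for p i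
      using fle[of p] descents_before_mono[of i n \<sigma>] that by simp
    moreover have "f p + ?c i \<le> f q + ?c j"
      if "p \<in> P" "q \<in> P" "(p, q) \<in> r" "i \<le> j" for p q i j
      using fmono[of p q] descents_before_mono[of i j \<sigma>] that by simp
    moreover have "f p + ?c i < f q + ?c j"
      if H: "p \<in> P" "q \<in> P" "(p, q) \<in> r" "i \<in> {1..n}" "j \<in> {1..n}" "i \<le> j" "?u (q, j) < ?u (p, i)" for p q i j
    proof (cases "i = j")
      case True
      then have "v q < v p" using H canon_labeling_less_iff[OF v \<sigma>, of q p j i] by auto
      then show ?thesis using fless[of p q] H True by simp
    next
      case False
      then have "\<sigma> j < \<sigma> i" using H canon_labeling_less_iff[OF v \<sigma>, of q p j i] by auto
      then show ?thesis using descents_before_less[of i j \<sigma>] fmono[of p q] H False by simp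
    qed
    ultimately show ?thesis
      unfolding pw_partition_def prod_chain_rel_def by auto
  qed
  moreover have "(\<forall>s\<in>P \<times> {1..n}. (\<lambda>(p, j). f p + ?c j) s \<le> \<tau> s \<and>
        \<tau> s + (d + ?c n) \<le> k + (\<lambda>(p, j). f p + ?c j) s) \<and>
      (\<forall>s\<in>P \<times> {1..n}. \<forall>t\<in>P \<times> {1..n}. (s, t) \<in> ?R \<longrightarrow>
        \<tau> s + (\<lambda>(p, j). f p + ?c j) t \<le> \<tau> t + (\<lambda>(p, j). f p + ?c j) s)"
    if \<tau>: "pw_partition (P \<times> {1..n}) ?R ?u k \<tau>" for k \<tau>
  proof -
    have row: "pw_partition P r v k (\<lambda>p. \<tau> (p, j))" if j: "j \<in> {1..n}" for j
      unfolding pw_partition_def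
    proof (intro conjI ballI impI)
      fix p assume "p \<in> P"
      then show "\<tau> (p, j) \<le> k" using \<tau> j by (auto simp: pw_partition_def)
    next
      fix p q assume pq: "p \<in> P" "q \<in> P" "(p, q) \<in> r"
      have R: "((p, j), (q, j)) \<in> ?R" using pq j by (auto simp: prod_chain_rel_def)
      then show "\<tau> (p, j) \<le> \<tau> (q, j)" using \<tau> pq j by (auto simp: pw_partition_def)
      assume "p \<noteq> q \<and> v q < v p"
      then show "\<tau> (p, j) < \<tau> (q, j)"
        using \<tau> pq j R canon_labeling_less_iff[OF v \<sigma>, of q p j j] by (auto simp: pw_partition_def)
    qed
    have f1: "f p \<le> \<tau> (p, j)" "\<tau> (p, j) + d \<le> k + f p" if "p \<in> P" "j \<in> {1..n}" for p j
      using least row[of j] that by (auto simp: least_partition_def)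
    have f2: "\<tau> (p, j) + f q \<le> \<tau> (q, j) + f p"
      if "p \<in> P" "q \<in> P" "(p, q) \<in> r" "j \<in> {1..n}" for p q j
    proof -
      have "\<forall>s\<in>P. \<forall>t\<in>P. (s, t) \<in> r \<longrightarrow> \<tau> (s, j) + f t \<le> \<tau> (t, j) + f s"
        using least row[of j] that(4) unfolding least_partition_def by blast
      then show ?thesis using that by blast
    qed
    \<comment> \<open>On an adjacent pair in a column the labels drop exactly when
      \<open>\<sigma>\<close> has a descent at \<open>j\<close>; \<open>col\<close> chains these
      steps.\<close>
    have cover: "\<tau> (p, j) + ?c (Suc j) \<le> \<tau> (p, Suc j) + ?c j" if "p \<in> P" "1 \<le> j" "Suc j \<le> n" for p j
    proof -
      have R: "((p, j), (p, Suc j)) \<in> ?R"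
        using that refl by (auto simp: prod_chain_rel_def refl_on_def)
      then have "\<tau> (p, j) \<le> \<tau> (p, Suc j)" using \<tau> that by (auto simp: pw_partition_def)
      moreover have "\<tau> (p, j) < \<tau> (p, Suc j)" if "\<sigma> (Suc j) < \<sigma> j"
        using \<tau> R that \<open>p \<in> P\<close> \<open>1 \<le> j\<close> \<open>Suc j \<le> n\<close>
          canon_labeling_less_iff[OF v \<sigma>, of p p "Suc j" j] by (auto simp: pw_partition_def)
      ultimately show ?thesis using descents_before_Suc[of j \<sigma>] that by auto
    qed
    have col: "\<tau> (p, i) + ?c j \<le> \<tau> (p, j) + ?c i" if "p \<in> P" "1 \<le> i" "i \<le> j" "j \<le> n" for p i j
      using that(3,4)
    proof (induction j rule: dec_induct)
      case (step j)
      then show ?case using cover[of p j] that by simp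
    qed simp
    \<comment> \<open>The lower bound climbs from height 1, where \<open>?c\<close> vanishes; the
      upper bound below climbs on to height \<open>n\<close>.\<close>
    have "f p + ?c j \<le> \<tau> (p, j)" if "p \<in> P" "j \<in> {1..n}" for p j
      using col[of p 1 j] f1(1)[of p 1] that n by (simp add: descents_before_def)
    moreover have "\<tau> (p, j) + (d + ?c n) \<le> k + (f p + ?c j)" if "p \<in> P" "j \<in> {1..n}" for p j
      using col[of p j n] f1(2)[of p n] that n by simp
    moreover have "\<tau> (p, i) + (f q + ?c j) \<le> \<tau> (q, j) + (f p + ?c i)"
      if "p \<in> P" "q \<in> P" "(p, q) \<in> r" "i \<in> {1..n}" "j \<in> {1..n}" "i \<le> j" for p q i j
      using col[of p i j] f2[of p q j] that by simp
    ultimately show ?thesis unfolding prod_chain_rel_def by auto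
  qed
  ultimately show ?thesis unfolding least_partition_def by blast
qed

subsection \<open>The rank function of a graded poset\<close>

lemma finite_chain_extends_to_maximal:
  assumes "finite P" "r \<subseteq> P \<times> P" "C \<in> Chains r"
  obtains M where "maximal_chain r M" "C \<subseteq> M"
proof -
  have "Chains r \<subseteq> Pow P" using assms(2) by (auto simp: Chains_def)
  then have "finite (Chains r)" using assms(1) by (auto intro: finite_subset)
  from finite_has_maximal2[OF this assms(3)] show ?thesis
    using that by (auto simp: maximal_chain_def)
qed

text \<open>The rank of \<open>s\<close> is the number of elements below it in any maximal chain
  through it, and \<open>l\<close> is the common length of these chains. The count above
  \<open>s\<close> is recorded as well because it yields the upper bounds on partitions.\<close>

lemma graded_rank:
  assumes "finite P" "P \<noteq> {}" and po: "partial_order_on P r" and "graded r"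
  obtains \<rho> l where "l < card P"
    "\<And>C s. maximal_chain r C \<Longrightarrow> s \<in> C \<Longrightarrow>
       card {c \<in> C. (c, s) \<in> r \<and> c \<noteq> s} = \<rho> s \<and> card {c \<in> C. (s, c) \<in> r \<and> c \<noteq> s} + \<rho> s = l"
proof -
  have rP: "r \<subseteq> P \<times> P" and rf: "refl_on P r" and tr: "trans r" and as: "antisym r"
    using po by (auto simp: partial_order_on_def preorder_on_def)
  let ?b = "\<lambda>C s. {c \<in> C. (c, s) \<in> r \<and> c \<noteq> s}" and ?a = "\<lambda>C s. {c \<in> C. (s, c) \<in> r \<and> c \<noteq> s}"
  have sub: "C \<subseteq> P" if "C \<in> Chains r" for C
    using that rP by (auto simp: Chains_def)
  have "{} \<in> Chains r" by (simp add: Chains_def)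
  then obtain M where M: "maximal_chain r M"
    using finite_chain_extends_to_maximal[OF assms(1) rP] by blast
  define N where "N = card M"
  have N: "card C = N" if "maximal_chain r C" for C
    using that M assms(4) unfolding graded_def N_def by blast
  \<comment> \<open>Glue the part of \<open>C\<close> below \<open>s\<close> to the part of \<open>D\<close> above \<open>s\<close>. Exchanging \<open>C\<close> and \<open>D\<close> shows
    that the number of elements below \<open>s\<close> does not depend on the maximal chain.\<close>
  have le: "card (?b C s) + card (?a D s) + 1 \<le> N"
    if "maximal_chain r C" "maximal_chain r D" "s \<in> C" "s \<in> D" for C D s
  proof -
    have CD: "C \<in> Chains r" "D \<in> Chains r" using that by (auto simp: maximal_chain_def)
    have fin: "finite C" "finite D" using CD sub assms(1) by (meson finite_subset)+
    let ?E = "insert s (?b C s \<union> ?a D s)"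
    have "s \<in> P" using sub CD that by auto
    \<comment> \<open>Transitivity through \<open>s\<close> makes the lower part comparable with the
      upper part.\<close>
    then have "?E \<in> Chains r"
      using CD rf unfolding Chains_def refl_on_def by (auto dest: transD[OF tr])
    then obtain F where F: "maximal_chain r F" "?E \<subseteq> F"
      using finite_chain_extends_to_maximal[OF assms(1) rP] by blast
    have "finite F" using F sub assms(1) by (auto simp: maximal_chain_def intro: finite_subset)
    then have "card ?E \<le> N" using F N card_mono by blast
    moreover have "?b C s \<inter> ?a D s = {}" using as by (auto dest: antisymD)
    then have "card ?E = card (?b C s) + card (?a D s) + 1"
      using fin by (subst card_insert_disjoint) (auto simp: card_Un_disjoint)
    ultimately show ?thesis by simp
  qed
  have eq: "card (?b C s) + card (?a C s) + 1 = N" if "maximal_chain r C" "s \<in> C" for C s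
  proof -
    have C: "C \<in> Chains r" using that by (auto simp: maximal_chain_def)
    have fin: "finite C" using C sub assms(1) by (meson finite_subset)
    have "C = insert s (?b C s \<union> ?a C s)" using C that by (auto simp: Chains_def)
    then have "N = card (insert s (?b C s \<union> ?a C s))" using N that by metis
    moreover have "?b C s \<inter> ?a C s = {}" using as by (auto dest: antisymD)
    ultimately show ?thesis
      using fin by (subst (asm) card_insert_disjoint) (auto simp: card_Un_disjoint)
  qed
  \<comment> \<open>The choice is harmless: \<open>le\<close> in both directions together with
    \<open>eq\<close> gives the same count for every maximal chain through \<open>s\<close>.\<close>
  define \<rho> where "\<rho> s = card (?b (SOME C. maximal_chain r C \<and> s \<in> C) s)" for s
  have "card (?b C s) = \<rho> s \<and> card (?a C s) + \<rho> s = N - 1" if C: "maximal_chain r C" "s \<in> C" for C s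
  proof -
    let ?D = "SOME C. maximal_chain r C \<and> s \<in> C"
    have D: "maximal_chain r ?D \<and> s \<in> ?D" using C by (metis (mono_tags, lifting) someI)
    have "card (?b C s) = card (?b ?D s)"
      using le[of C ?D s] le[of ?D C s] eq[of C s] eq[of ?D s] C D by linarith
    then show ?thesis using eq[of C s] C unfolding \<rho>_def by linarith
  qed
  moreover have "N - 1 < card P"
  proof -
    have "N \<le> card P" unfolding N_def
      using M sub assms(1) by (intro card_mono) (auto simp: maximal_chain_def)
    moreover have "card P > 0" using assms by (simp add: card_gt_0_iff)
    ultimately show ?thesis by linarith
  qed
  ultimately show ?thesis by (rule that[rotated])
qed

text \<open>Under the complemented labeling every strict relation reverses the labels, so partitions
  are strictly increasing. Their values on a maximal chain are distinct, and counting chain elements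
  below, above and between gives the bounds in terms of \<open>\<rho>\<close>.\<close>

lemma least_partition_rank:
  assumes "finite P" "P \<noteq> {}" and po: "partial_order_on P r" and "graded r"
    and nat: "natural_labeling P r w"
  obtains \<rho> l where "l < card P" "least_partition P r (\<lambda>p. card P + 1 - w p) \<rho> l"
proof -
  have rP: "r \<subseteq> P \<times> P" and rf: "refl_on P r" and tr: "trans r" and as: "antisym r"
    using po by (auto simp: partial_order_on_def preorder_on_def)
  obtain \<rho> l where l: "l < card P" and
    rank: "\<And>C s. maximal_chain r C \<Longrightarrow> s \<in> C \<Longrightarrow>
       card {c \<in> C. (c, s) \<in> r \<and> c \<noteq> s} = \<rho> s \<and> card {c \<in> C. (s, c) \<in> r \<and> c \<noteq> s} + \<rho> s = l"
    by (rule graded_rank[OF assms(1-4)]) blast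
  let ?w = "\<lambda>p. card P + 1 - w p"
  have strict: "?w t < ?w s" if "s \<in> P" "t \<in> P" "(s, t) \<in> r" "s \<noteq> t" for s t
  proof -
    have "w s < w t" using nat that by (auto simp: natural_labeling_def)
    moreover have "w t \<le> card P" using nat that
      by (auto simp: natural_labeling_def labeling_def bij_betw_def)
    ultimately show ?thesis by simp
  qed
  have chain: "\<exists>C. maximal_chain r C \<and> s \<in> C \<and> t \<in> C \<and> finite C \<and> C \<subseteq> P \<and> C \<in> Chains r"
    if "s \<in> P" "t \<in> P" "(s, t) \<in> r" for s t
  proof -
    have "{s, t} \<in> Chains r" using that rf by (auto simp: Chains_def refl_on_def)
    then obtain C where C: "maximal_chain r C" "{s, t} \<subseteq> C"
      using finite_chain_extends_to_maximal[OF assms(1) rP] by blast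
    then have "C \<in> Chains r" by (auto simp: maximal_chain_def)
    moreover from this have "C \<subseteq> P" using rP by (auto simp: Chains_def)
    ultimately show ?thesis using C assms(1) by (auto intro: finite_subset)
  qed
  have inj: "inj_on \<tau> C" if "pw_partition P r ?w k \<tau>" "C \<in> Chains r" "C \<subseteq> P" for k \<tau> C
  proof (rule inj_onI, rule ccontr)
    fix a b assume ab: "a \<in> C" "b \<in> C" "\<tau> a = \<tau> b" "a \<noteq> b"
    then have "(a, b) \<in> r \<or> (b, a) \<in> r" using that by (auto simp: Chains_def)
    moreover have "a \<in> P" "b \<in> P" using ab that by auto
    ultimately have "\<tau> a < \<tau> b \<or> \<tau> b < \<tau> a"
      using that(1) strict[of a b] strict[of b a] ab(4) unfolding pw_partition_def by metis
    with ab show False by simp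
  qed
  have less: "\<tau> s < \<tau> t" if "pw_partition P r ?w k \<tau>" "s \<in> P" "t \<in> P" "(s, t) \<in> r" "s \<noteq> t" for k \<tau> s t
    using that strict[of s t] unfolding pw_partition_def by metis
  have "\<rho> s \<le> l" if "s \<in> P" for s
    using chain[of s s] rank that rf by (fastforce simp: refl_on_def)
  moreover have mono: "\<rho> s < \<rho> t" if st: "s \<in> P" "t \<in> P" "(s, t) \<in> r" "s \<noteq> t" for s t
  proof -
    obtain C where C: "maximal_chain r C" "s \<in> C" "t \<in> C" "finite C" using chain st by blast
    have "{c \<in> C. (c, s) \<in> r \<and> c \<noteq> s} \<subset> {c \<in> C. (c, t) \<in> r \<and> c \<noteq> t}"
    proof
      show "{c \<in> C. (c, s) \<in> r \<and> c \<noteq> s} \<subseteq> {c \<in> C. (c, t) \<in> r \<and> c \<noteq> t}"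
        using st transD[OF tr, of _ s t] antisymD[OF as, of s t] by blast
      show "{c \<in> C. (c, s) \<in> r \<and> c \<noteq> s} \<noteq> {c \<in> C. (c, t) \<in> r \<and> c \<noteq> t}"
        using C st by blast
    qed
    then have "card {c \<in> C. (c, s) \<in> r \<and> c \<noteq> s} < card {c \<in> C. (c, t) \<in> r \<and> c \<noteq> t}"
      using C by (intro psubset_card_mono) auto
    then show ?thesis using rank[OF C(1,2)] rank[OF C(1,3)] by simp
  qed
  moreover have "\<rho> s \<le> \<rho> t" if "s \<in> P" "t \<in> P" "(s, t) \<in> r" for s t
    using mono[OF that] by (cases "s = t") auto
  ultimately have "pw_partition P r ?w l \<rho>" by (auto simp: pw_partition_def)
  moreover have "\<rho> s \<le> \<tau> s \<and> \<tau> s + l \<le> k + \<rho> s" if \<tau>: "pw_partition P r ?w k \<tau>" and s: "s \<in> P" for k \<tau> s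
  proof -
    obtain C where C: "maximal_chain r C" "s \<in> C" "finite C" "C \<subseteq> P" "C \<in> Chains r"
      using chain[of s s] s rf by (auto simp: refl_on_def)
    \<comment> \<open>The \<open>\<rho> s\<close> chain elements below \<open>s\<close> have
      distinct values under \<open>\<tau> s\<close>; the \<open>l - \<rho> s\<close> elements above
      have distinct values in \<open>{\<tau> s<..k}\<close>.\<close>
    have "card {c \<in> C. (c, s) \<in> r \<and> c \<noteq> s} \<le> card {..<\<tau> s}"
      using less[OF \<tau>] C s by (intro card_inj_on_le[of \<tau>] inj_on_subset[OF inj[OF \<tau> C(5,4)]]) auto
    moreover have "card {c \<in> C. (s, c) \<in> r \<and> c \<noteq> s} \<le> card {\<tau> s<..k}"
      using less[OF \<tau>] C s \<tau>
      by (intro card_inj_on_le[of \<tau>] inj_on_subset[OF inj[OF \<tau> C(5,4)]]) (auto simp: pw_partition_def)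
    moreover have "\<tau> s \<le> k" using \<tau> s by (auto simp: pw_partition_def)
    ultimately show ?thesis using rank[OF C(1,2)] unfolding card_lessThan card_greaterThanAtMost by linarith
  qed
  moreover have "\<tau> s + \<rho> t \<le> \<tau> t + \<rho> s"
    if \<tau>: "pw_partition P r ?w k \<tau>" and s: "s \<in> P" "t \<in> P" "(s, t) \<in> r" for k \<tau> s t
  proof (cases "s = t")
    case False
    obtain C where C: "maximal_chain r C" "s \<in> C" "t \<in> C" "finite C" "C \<subseteq> P" "C \<in> Chains r"
      using chain[of s t] s by blast
    \<comment> \<open>The chain from \<open>s\<close> inclusive to \<open>t\<close> exclusive has at
      least \<open>\<rho> t - \<rho> s\<close> elements, and their distinct values lie in
      \<open>{\<tau> s..<\<tau> t}\<close>.\<close>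
    let ?I = "{c \<in> C. (s, c) \<in> r \<and> (c, t) \<in> r \<and> c \<noteq> t}"
    have "\<tau> ` ?I \<subseteq> {\<tau> s..<\<tau> t}"
      using less[OF \<tau>] C s \<tau> by (auto simp: pw_partition_def)
    then have "card ?I \<le> card {\<tau> s..<\<tau> t}"
      by (intro card_inj_on_le[of \<tau>] inj_on_subset[OF inj[OF \<tau> C(6,5)]]) auto
    moreover have "{c \<in> C. (c, t) \<in> r \<and> c \<noteq> t} = {c \<in> C. (c, s) \<in> r \<and> c \<noteq> s} \<union> ?I"
    proof -
      have "(s, c) \<in> r \<or> (c, s) \<in> r" if "c \<in> C" for c using C that by (auto simp: Chains_def)
      moreover have "(s, s) \<in> r" using rf s by (auto simp: refl_on_def)
      ultimately show ?thesis
        using s False transD[OF tr, of _ s t] antisymD[OF as, of s t] by blast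
    qed
    then have "card {c \<in> C. (c, t) \<in> r \<and> c \<noteq> t} \<le> card {c \<in> C. (c, s) \<in> r \<and> c \<noteq> s} + card ?I"
      by (simp add: card_Un_le)
    moreover have "\<tau> s < \<tau> t" using less[OF \<tau>] s False by auto
    ultimately show ?thesis using rank[OF C(1,2)] rank[OF C(1,3)] by simp
  qed simp
  ultimately have "least_partition P r ?w \<rho> l" unfolding least_partition_def by blast
  with l show ?thesis by (rule that)
qed

subsection \<open>The canon polynomial\<close>

text \<open>The comparison of labels gives injectivity; surjectivity then follows by
  counting.\<close>

lemma labeling_canon:
  assumes "finite P" and v: "labeling P v" and \<sigma>: "\<sigma> permutes {1..n}"
  shows "labeling (P \<times> {1..n}) (canon_labeling P v \<sigma>)"
proof -
  let ?u = "canon_labeling P v \<sigma>" and ?Q = "P \<times> {1..n}"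
  have inj: "inj_on ?u ?Q"
  proof (rule inj_onI, clarify)
    fix p i q j assume H: "p \<in> P" "q \<in> P" "i \<in> {1..n}" "j \<in> {1..n}" "?u (p, i) = ?u (q, j)"
    then have "\<not> ?u (p, i) < ?u (q, j)" "\<not> ?u (q, j) < ?u (p, i)" by auto
    then have *: "\<sigma> i = \<sigma> j" "i = j \<Longrightarrow> v p = v q"
      using canon_labeling_less_iff[OF v \<sigma>, of p q i j] canon_labeling_less_iff[OF v \<sigma>, of q p j i] H
      by auto
    then have "i = j" using permutes_inj[OF \<sigma>] by (simp add: inj_eq)
    with * H v show "p = q \<and> i = j" by (auto simp: labeling_def bij_betw_def inj_on_def)
  qed
  have "?u (p, i) \<in> {1..card ?Q}" if "p \<in> P" "i \<in> {1..n}" for p i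
  proof -
    have "1 \<le> v p" "v p \<le> card P" using v that by (auto simp: labeling_def bij_betw_def)
    moreover have "1 \<le> \<sigma> i" "\<sigma> i \<le> n" using permutes_in_image[OF \<sigma>, of i] that by auto
    then have "(\<sigma> i - 1 + 1) * card P \<le> n * card P" by (intro mult_le_mono1) simp
    then have "(\<sigma> i - 1) * card P + card P \<le> n * card P" by simp
    ultimately show ?thesis
      by (auto simp: canon_labeling_def card_cartesian_product mult.commute)
  qed
  then have "?u ` ?Q \<subseteq> {1..card ?Q}" by auto
  moreover have "card (?u ` ?Q) = card {1..card ?Q}"
    unfolding card_image[OF inj] by simp
  ultimately have "?u ` ?Q = {1..card ?Q}"
    by (intro card_subset_eq finite_atLeastAtMost)
  then show ?thesis using inj by (simp add: labeling_def bij_betw_def)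
qed

text \<open>This supplies a concrete natural labeling of the product, by which
  \<open>hstar_poset\<close> can be evaluated.\<close>

lemma natural_labeling_canon_id:
  assumes "finite P" and nat: "natural_labeling P r w"
  shows "natural_labeling (P \<times> {1..n}) (prod_chain_rel r n) (canon_labeling P w id)"
  unfolding natural_labeling_def
proof (intro conjI ballI impI)
  have w: "labeling P w" using nat by (simp add: natural_labeling_def)
  show "labeling (P \<times> {1..n}) (canon_labeling P w id)"
    by (rule labeling_canon[OF assms(1) w permutes_id])
  fix s t assume st: "s \<in> P \<times> {1..n}" "t \<in> P \<times> {1..n}" "(s, t) \<in> prod_chain_rel r n \<and> s \<noteq> t"
  obtain p i q j where [simp]: "s = (p, i)" "t = (q, j)" by (metis surj_pair)
  have "i < j \<or> i = j \<and> w p < w q"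
    using st nat by (auto simp: prod_chain_rel_def natural_labeling_def)
  then show "canon_labeling P w id s < canon_labeling P w id t"
    using canon_labeling_less_iff[OF w permutes_id, of p q i n j] st by auto
qed

lemma sum_lin_ext_words:
  assumes "inj_on u Q"
  shows "(\<Sum>\<pi>\<in>lin_ext_words Q R u. g \<pi>) = (\<Sum>ps\<in>linear_extensions Q R. g (map u ps))"
proof -
  have "inj_on (map u) (linear_extensions Q R)"
    using assms by (intro inj_on_mapI) (auto simp: linear_extensions_def intro: inj_on_subset)
  then show ?thesis by (simp add: lin_ext_words_def sum.reindex)
qed

lemma canon_poly_eq_sum_hstar:
  assumes "finite P" and "labeling P w"
  shows "canon_poly P r w n =
    (\<Sum>\<sigma> | \<sigma> permutes {1..n}. hstar (P \<times> {1..n}) (prod_chain_rel r n) (canon_labeling P w \<sigma>))"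
  unfolding canon_poly_def
proof (rule sum.cong[OF refl])
  fix \<sigma> assume "\<sigma> \<in> {\<sigma>. \<sigma> permutes {1..n}}"
  then have "inj_on (canon_labeling P w \<sigma>) (P \<times> {1..n})"
    using labeling_canon[OF assms, of \<sigma> n] by (auto simp: labeling_def bij_betw_def)
  then show "(\<Sum>\<pi>\<in>lin_ext_words (P \<times> {1..n}) (prod_chain_rel r n) (canon_labeling P w \<sigma>). monom 1 (des \<pi>)) =
      hstar (P \<times> {1..n}) (prod_chain_rel r n) (canon_labeling P w \<sigma>)"
    using assms by (simp add: sum_lin_ext_words hstar_eq_sum_des)
qed

text \<open>Here \<open>w\<close> serves to label the product naturally, while \<open>v\<close>
  varies: \<open>v = w\<close> with \<open>f = 0\<close> gives the factorization, and the complement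
  of \<open>w\<close> with the rank function gives the shift needed for palindromicity.\<close>

lemma canon_poly_least_partition:
  assumes "finite P" "P \<noteq> {}" and po: "partial_order_on P r" and nat: "natural_labeling P r w"
    and n: "n \<ge> 1" and v: "labeling P v" and least: "least_partition P r v f d"
  shows "canon_poly P r v n =
    monom 1 d * (eulerian_poly n * hstar_poset (P \<times> {1..n}) (prod_chain_rel r n))"
proof -
  let ?Q = "P \<times> {1..n}" and ?R = "prod_chain_rel r n"
  have natQ: "natural_labeling ?Q ?R (canon_labeling P w id)"
    by (rule natural_labeling_canon_id[OF assms(1) nat])
  have "refl_on P r" using po by (auto simp: partial_order_on_def preorder_on_def)
  then have "hstar ?Q ?R (canon_labeling P v \<sigma>) =
      monom 1 (d + des (map \<sigma> [1..<n+1])) * hstar_poset ?Q ?R" if "\<sigma> permutes {1..n}" for \<sigma>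
    unfolding des_map_upt hstar_poset_eq[OF natQ]
    using assms that
    by (intro hstar_least_partition[OF _ _ natQ least_partition_prod_chain[OF _ n v that least]]) auto
  then show ?thesis
    unfolding canon_poly_eq_sum_hstar[OF assms(1) v] eulerian_poly_def
    by (simp add: sum_distrib_left sum_distrib_right mult.assoc[symmetric] mult_monom del: upt_Suc)
qed

section \<open>Complementation and palindromicity\<close>

text \<open>With distinct letters every adjacent pair is an ascent or a descent, and
  \<open>x \<mapsto> N - x\<close> swaps the two.\<close>

lemma des_complement:
  assumes "distinct u" and "set u \<subseteq> {..N}"
  shows "des (map (\<lambda>x. N - x) u) + des u = length u - 1"
proof -
  let ?A = "{i. Suc i < length u \<and> u ! i < u ! Suc i}"
  let ?D = "{i. Suc i < length u \<and> u ! Suc i < u ! i}"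
  have "N - u ! Suc i < N - u ! i \<longleftrightarrow> u ! i < u ! Suc i" if "Suc i < length u" for i
  proof -
    have "u ! Suc i \<le> N" using assms(2) nth_mem[OF that] by blast
    then show ?thesis by linarith
  qed
  then have "des (map (\<lambda>x. N - x) u) = card ?A"
    unfolding des_def by (intro arg_cong[where f = card]) auto
  moreover have "des u = card ?D" by (simp add: des_def)
  moreover have "finite ?A" "finite ?D"
    by (rule finite_subset[of _ "{..<length u}"], auto)+
  then have "card (?A \<union> ?D) = card ?A + card ?D" by (intro card_Un_disjoint) auto
  moreover have "u ! i < u ! Suc i \<or> u ! Suc i < u ! i" if "Suc i < length u" for i
    using assms(1) that unfolding linorder_neq_iff[symmetric] by (simp add: nth_eq_iff_index_eq)
  then have "?A \<union> ?D = {..<length u - 1}"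
    unfolding set_eq_iff by (simp add: less_diff_conv) blast
  ultimately show ?thesis by simp
qed

lemma canon_labeling_complement:
  assumes "labeling P w" and \<sigma>: "\<sigma> permutes {1..n}" and "p \<in> P" "j \<in> {1..n}"
    and "\<sigma>' j = n + 1 - \<sigma> j"
  shows "canon_labeling P (\<lambda>p. card P + 1 - w p) \<sigma>' (p, j) =
    card P * n + 1 - canon_labeling P w \<sigma> (p, j)"
proof -
  have w: "1 \<le> w p" "w p \<le> card P" using assms by (auto simp: labeling_def bij_betw_def)
  have s: "1 \<le> \<sigma> j" "\<sigma> j \<le> n" using permutes_in_image[OF \<sigma>, of j] assms by auto
  \<comment> \<open>Writing \<open>\<sigma> j = a + 1\<close> and \<open>n = a + b + 1\<close>
    removes the truncated subtractions.\<close>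
  then obtain a where a: "\<sigma> j = Suc a" by (cases "\<sigma> j") auto
  then obtain b where b: "n = Suc (a + b)" using s less_eq_Suc_le less_imp_Suc_add by metis
  show ?thesis using w assms(5) by (simp add: canon_labeling_def a b algebra_simps)
qed

lemma labeling_complement:
  assumes "labeling P w"
  shows "labeling P (\<lambda>p. card P + 1 - w p)"
proof -
  have "bij_betw (\<lambda>i. card P + 1 - i) {1..card P} {1..card P}"
    by (rule bij_betw_byWitness[where f' = "\<lambda>i. card P + 1 - i"]) auto
  from bij_betw_trans[OF assms[unfolded labeling_def] this] show ?thesis
    by (simp add: labeling_def comp_def)
qed

text \<open>Reversing the values of \<open>\<sigma>\<close> permutes the outer sum. Combined with
  \<open>w'\<close> it complements the whole canon label, so each linear extension has its descents
  and ascents exchanged.\<close>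

lemma canon_poly_complement:
  assumes "finite P" and w: "labeling P w"
  defines "w' \<equiv> \<lambda>p. card P + 1 - w p"
  shows "canon_poly P r w' n = (\<Sum>\<sigma> | \<sigma> permutes {1..n}.
    \<Sum>ps\<in>linear_extensions (P \<times> {1..n}) (prod_chain_rel r n).
      monom 1 (card P * n - 1 - des (map (canon_labeling P w \<sigma>) ps)))"
proof -
  let ?Q = "P \<times> {1..n}" and ?L = "linear_extensions (P \<times> {1..n}) (prod_chain_rel r n)"
  \<comment> \<open>This is the reversal of \<open>{1..n}\<close>, extended by the identity so that
    it permutes \<open>{1..n}\<close>.\<close>
  define c where "c i = (if i \<in> {1..n} then n + 1 - i else i)" for i
  have "bij_betw c {1..n} {1..n}"
    by (rule bij_betw_byWitness[where f' = c]) (auto simp: c_def)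
  then have c: "c permutes {1..n}" by (rule bij_imp_permutes) (auto simp: c_def)
  have w': "labeling P w'" unfolding w'_def by (rule labeling_complement[OF w])
  have "canon_poly P r w' n = (\<Sum>\<sigma> | \<sigma> permutes {1..n}.
      hstar ?Q (prod_chain_rel r n) (canon_labeling P w' (c \<circ> \<sigma>)))"
    unfolding canon_poly_eq_sum_hstar[OF assms(1) w']
    using c by (rule setum_permutations_compose_left)
  also have "\<dots> = (\<Sum>\<sigma> | \<sigma> permutes {1..n}. \<Sum>ps\<in>?L.
      monom 1 (card P * n - 1 - des (map (canon_labeling P w \<sigma>) ps)))"
  proof (rule sum.cong[OF refl])
    fix \<sigma> assume "\<sigma> \<in> {\<sigma>. \<sigma> permutes {1..n}}"
    then have \<sigma>: "\<sigma> permutes {1..n}" by simp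
    let ?u = "canon_labeling P w \<sigma>" and ?u' = "canon_labeling P w' (c \<circ> \<sigma>)"
    have "inj_on ?u' ?Q"
      using labeling_canon[OF assms(1) w' permutes_compose[OF \<sigma> c]]
      by (simp add: labeling_def bij_betw_def)
    then have "hstar ?Q (prod_chain_rel r n) ?u' = (\<Sum>ps\<in>?L. monom 1 (des (map ?u' ps)))"
      using assms(1) by (simp add: hstar_eq_sum_des)
    also have "\<dots> = (\<Sum>ps\<in>?L. monom 1 (card P * n - 1 - des (map ?u ps)))"
    proof (rule sum.cong[OF refl])
      fix ps assume "ps \<in> ?L"
      then have ps: "distinct ps" "set ps = ?Q" by (auto simp: linear_extensions_def)
      have u: "bij_betw ?u ?Q {1..card P * n}"
        using labeling_canon[OF assms(1) w \<sigma>] by (simp add: labeling_def card_cartesian_product)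
      have "?u' s = card P * n + 1 - ?u s" if "s \<in> ?Q" for s
        using canon_labeling_complement[OF w \<sigma>, of "fst s" "snd s" "c \<circ> \<sigma>"] that
          permutes_in_image[OF \<sigma>, of "snd s"] by (auto simp: c_def w'_def)
      then have "map ?u' ps = map (\<lambda>x. card P * n + 1 - x) (map ?u ps)" using ps by simp
      moreover have "length ps = card P * n"
        using ps distinct_card[of ps] by (simp add: card_cartesian_product)
      moreover have "distinct (map ?u ps)" "set (map ?u ps) \<subseteq> {..card P * n + 1}"
        using ps u by (auto simp: distinct_map bij_betw_def)
      ultimately have "des (map ?u' ps) + des (map ?u ps) = card P * n - 1"
        using des_complement[of "map ?u ps" "card P * n + 1"] by (simp only: length_map)
      then have "des (map ?u' ps) = card P * n - 1 - des (map ?u ps)" by linarith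
      then show "monom 1 (des (map ?u' ps)) = (monom 1 (card P * n - 1 - des (map ?u ps)) :: int poly)"
        by simp
    qed
    finally show "hstar ?Q (prod_chain_rel r n) ?u' =
        (\<Sum>ps\<in>?L. monom 1 (card P * n - 1 - des (map ?u ps)))" .
  qed
  finally show ?thesis .
qed

text \<open>The hypothesis reads \<open>x^M f(1/x) = x^l f(x)\<close>. The vanishing low
  coefficients on the right bound the degree of \<open>f\<close> by \<open>M - l\<close>, and
  cancelling \<open>x^l\<close> leaves symmetry with \<open>d = M - l\<close>.\<close>

lemma palindromic_if_reflection_eq_shift:
  assumes deg: "degree f \<le> M" and "l \<le> M"
    and refl: "\<And>i. i \<le> M \<Longrightarrow> coeff f (M - i) = coeff (monom 1 l * f) i"
  shows "palindromic f"
  unfolding palindromic_def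
proof (intro exI conjI allI impI)
  have shift: "coeff f (M - i) = (if i < l then 0 else coeff f (i - l))" if "i \<le> M" for i
    using refl[OF that] by (simp add: coeff_monom_mult)
  show "degree f \<le> M - l"
  proof (rule degree_le, intro allI impI)
    fix i assume i: "M - l < i"
    show "coeff f i = 0"
    proof (cases "i \<le> M")
      case True then show ?thesis using shift[of "M - i"] i by simp
    next
      case False then show ?thesis using deg by (intro coeff_eq_0) simp
    qed
  qed
  fix i assume "i \<le> M - l"
  then show "coeff f i = coeff f (M - l - i)"
    using shift[of "i + l"] assms(2) by (simp add: add.commute)
qed

text \<open>The canon polynomial of the complemented labeling is computed twice: as the reflection
  in degree \<open>card P * n - 1\<close>, and by \<open>compl\<close> as a shift by
  \<open>l\<close>.\<close>

lemma palindromic_canon_poly: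
  assumes "finite P" and w: "labeling P w" and "n \<ge> 1" and l: "l < card P"
    and compl: "canon_poly P r (\<lambda>p. card P + 1 - w p) n = monom 1 l * canon_poly P r w n"
  shows "palindromic (canon_poly P r w n)"
proof (rule palindromic_if_reflection_eq_shift)
  let ?M = "card P * n - 1" and ?S = "{\<sigma>. \<sigma> permutes {1..n}}"
  let ?L = "linear_extensions (P \<times> {1..n}) (prod_chain_rel r n)"
  let ?d = "\<lambda>\<sigma> ps. des (map (canon_labeling P w \<sigma>) ps)"
  have C: "canon_poly P r w n = (\<Sum>\<sigma>\<in>?S. \<Sum>ps\<in>?L. monom 1 (?d \<sigma> ps))"
    unfolding canon_poly_eq_sum_hstar[OF assms(1) w]
  proof (rule sum.cong[OF refl])
    fix \<sigma> assume "\<sigma> \<in> ?S"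
    then show "hstar (P \<times> {1..n}) (prod_chain_rel r n) (canon_labeling P w \<sigma>) =
        (\<Sum>ps\<in>?L. monom 1 (?d \<sigma> ps))"
      using labeling_canon[OF assms(1) w] assms(1)
      by (intro hstar_eq_sum_des) (auto simp: labeling_def bij_betw_def)
  qed
  \<comment> \<open>This bound keeps \<open>?M - ?d \<sigma> ps\<close> from being
    truncated.\<close>
  have le: "?d \<sigma> ps \<le> ?M" if "ps \<in> ?L" for \<sigma> ps
  proof -
    have "length ps = card P * n"
      using that distinct_card[of ps] by (auto simp: linear_extensions_def card_cartesian_product)
    then have "?d \<sigma> ps \<le> card {..<?M}"
      unfolding des_def by (intro card_mono) auto
    then show ?thesis by simp
  qed
  show "degree (canon_poly P r w n) \<le> ?M"
    unfolding C by (intro degree_sum_le)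
      (use le in \<open>auto simp: degree_monom_eq finite_permutations finite_linear_extensions assms(1)\<close>)
  have "card P * 1 \<le> card P * n" using assms by (intro mult_le_mono2)
  then show "l \<le> ?M" using l by linarith
  fix i assume i: "i \<le> ?M"
  have "coeff (monom 1 l * canon_poly P r w n) i =
      (\<Sum>\<sigma>\<in>?S. \<Sum>ps\<in>?L. coeff (monom 1 (?M - ?d \<sigma> ps)) i)"
    by (simp only: compl[symmetric] canon_poly_complement[OF assms(1) w] coeff_sum)
  also have "\<dots> = (\<Sum>\<sigma>\<in>?S. \<Sum>ps\<in>?L. coeff (monom 1 (?d \<sigma> ps)) (?M - i))"
  proof (intro sum.cong refl)
    fix \<sigma> ps assume "ps \<in> ?L"
    then have "?M - ?d \<sigma> ps = i \<longleftrightarrow> ?d \<sigma> ps = ?M - i"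
      using le[of ps \<sigma>] i by linarith
    then show "coeff (monom (1::int) (?M - ?d \<sigma> ps)) i = coeff (monom 1 (?d \<sigma> ps)) (?M - i)"
      by (simp only: coeff_monom)
  qed
  also have "\<dots> = coeff (canon_poly P r w n) (?M - i)"
    by (simp add: C coeff_sum)
  finally show "coeff (canon_poly P r w n) (?M - i) = coeff (monom 1 l * canon_poly P r w n) i" ..
qed

theorem theorem1p2:
  fixes P :: "'a set" and r :: "'a rel" and w :: "'a \<Rightarrow> nat" and n :: nat
  assumes "finite P" and "P \<noteq> {}" and "partial_order_on P r"
    and "natural_labeling P r w" and "n \<ge> 1"
  shows "canon_poly P r w n = eulerian_poly n * hstar_poset (P \<times> {1..n}) (prod_chain_rel r n)
    \<and> (graded r \<longrightarrow> palindromic (canon_poly P r w n))"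
proof (intro conjI impI)
  have w: "labeling P w" using assms(4) by (simp add: natural_labeling_def)
  show factor: "canon_poly P r w n = eulerian_poly n * hstar_poset (P \<times> {1..n}) (prod_chain_rel r n)"
    using canon_poly_least_partition[OF assms w least_partition_zero[OF assms(4)]] by simp
  assume "graded r"
  then obtain \<rho> l where l: "l < card P" "least_partition P r (\<lambda>p. card P + 1 - w p) \<rho> l"
    by (rule least_partition_rank[OF assms(1-3) _ assms(4)]) blast
  have "labeling P (\<lambda>p. card P + 1 - w p)"
    by (rule labeling_complement[OF w])
  \<comment> \<open>The Eulerian polynomial and \<open>hstar_poset\<close> are the same for both
    labelings, so by \<open>factor\<close> their product is the canon polynomial of
    \<open>w\<close>.\<close>
  then have "canon_poly P r (\<lambda>p. card P + 1 - w p) n = monom 1 l * canon_poly P r w n"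
    using canon_poly_least_partition[OF assms] l factor by simp
  then show "palindromic (canon_poly P r w n)"
    using palindromic_canon_poly assms w l by blast
qed

end
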